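(* The fractional-order equivalent circuit model consisting of an ohmic resistor $R_\infty$ in series with one parallel pair formed by a resistor $R_1$ and a constant phase element of impedance $\frac{1}{C_1 s^{\alpha_1}}$, with $\alpha_1\in(0,1)$ and with parameter vector $\theta=[R_\infty,R_1,C_1,\alpha_1]$, is structurally globally identifiable.
   Context: The circuit is represented by the discrete-time transfer function obtained from the circuit equations (Kirchhoff's laws, with the voltage across the constant phase element as the state) by the Grünwald-Letnikov discretisation of the fractional derivative: $$H(z,\theta)=d(\theta)+\frac{b_1(\theta)\,z^{T}}{z^{T+1}-\sum_{j=0}^{T}a_{1,j}(\theta)\,z^{T-j}},$$ where $$d(\theta)=R_\infty,\qquad b_1(\theta)=\frac{T_s^{\alpha_1}}{C_1},\qquad a_{1,0}(\theta)=\alpha_1-\frac{T_s^{\alpha_1}}{R_1C_1},\qquad a_{1,j}(\theta)=-(-1)^{j+1}\binom{\alpha_1}{j+1}\quad (j=1,\ldots,T).$$ Here $s$ is the Laplace variable, $C_1$ is a constant, $T_s$ is the sample time, $T$ is the data length (the number of samples), and the generalised binomial coefficients are $\binom{\alpha}{j}=\frac{\Gamma(\alpha+1)}{\Gamma(j+1)\Gamma(\alpha+1-j)}$, with $\Gamma$ the gamma function. A model with transfer function $H(z,\theta)$, parametrised by $\theta$ in an open subset $\mathcal{D}\subset\mathbb{R}^q$ (here $q=4$), is (structurally) globally identifiable if the equation "$H(z,\theta)=H(z,\theta^\ast)$ for almost all $z$", where $\theta,\theta^\ast\in\mathcal{D}$, has a unique solution in $\mathcal{D}$.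
   Formalization: The data length T is required to be at least 2, since for T = 0 the transfer function has only three coefficients and for T = 1 the orders α₁ and 1−α₁ (e.g. 1/4 and 3/4) give the same transfer function after readjusting the other parameters. *)

theory Defs
  imports "HOL-Analysis.Analysis"
begin

definition globally_identifiable ::
    "(real ^ 'q) set \<Rightarrow> (complex \<Rightarrow> real ^ 'q \<Rightarrow> complex) \<Rightarrow> bool" where
  "globally_identifiable D H \<longleftrightarrow>
     (\<forall>\<theta>'\<in>D. \<exists>!\<theta>. \<theta> \<in> D \<and> (AE z in lborel. H z \<theta> = H z \<theta>'))"

definition gen_binom :: "real \<Rightarrow> nat \<Rightarrow> real" where
  "gen_binom \<alpha> j = Gamma (\<alpha> + 1) / (Gamma (real j + 1) * Gamma (\<alpha> + 1 - real j))"

lemma gen_binom_eq_gchoose: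
  assumes "0 < \<alpha>" "\<alpha> < 1"
  shows "gen_binom \<alpha> j = \<alpha> gchoose j"
proof -
  have "\<alpha> + 1 \<notin> \<int>\<^sub>\<le>\<^sub>0"
    using assms by (auto elim!: nonpos_Ints_cases)
  then show ?thesis
    by (simp add: gen_binom_def gbinomial_Gamma Gamma_fact algebra_simps)
qed

text \<open>Components of the parameter vector: ohmic resistance, resistance of the parallel pair,
  constant and order of the constant phase element.\<close>

abbreviation R_inf :: "real ^ 4 \<Rightarrow> real" where "R_inf \<theta> \<equiv> \<theta> $ 1"
abbreviation R1 :: "real ^ 4 \<Rightarrow> real" where "R1 \<theta> \<equiv> \<theta> $ 2"
abbreviation C1 :: "real ^ 4 \<Rightarrow> real" where "C1 \<theta> \<equiv> \<theta> $ 3"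
abbreviation alpha1 :: "real ^ 4 \<Rightarrow> real" where "alpha1 \<theta> \<equiv> \<theta> $ 4"

text \<open>Only what is needed for the coefficients below to make sense, together with the range of
  the fractional order; in particular all physical (positive) parameter values are included.\<close>

definition admissible_params :: "(real ^ 4) set" where
  "admissible_params = {\<theta>. R1 \<theta> \<noteq> 0 \<and> C1 \<theta> \<noteq> 0 \<and> 0 < alpha1 \<theta> \<and> alpha1 \<theta> < 1}"

definition coeff_d :: "real ^ 4 \<Rightarrow> real" where
  "coeff_d \<theta> = R_inf \<theta>"

definition coeff_b :: "real \<Rightarrow> real ^ 4 \<Rightarrow> real" where
  "coeff_b Ts \<theta> = Ts powr alpha1 \<theta> / C1 \<theta>"

definition coeff_a :: "real \<Rightarrow> nat \<Rightarrow> real ^ 4 \<Rightarrow> real" where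
  "coeff_a Ts j \<theta> =
     (if j = 0 then alpha1 \<theta> - Ts powr alpha1 \<theta> / (R1 \<theta> * C1 \<theta>)
      else - ((- 1) ^ (j + 1) * gen_binom (alpha1 \<theta>) (j + 1)))"

definition transfer_fun :: "real \<Rightarrow> nat \<Rightarrow> complex \<Rightarrow> real ^ 4 \<Rightarrow> complex" where
  "transfer_fun Ts T z \<theta> =
     complex_of_real (coeff_d \<theta>) +
     complex_of_real (coeff_b Ts \<theta>) * z ^ T /
       (z ^ (T + 1) - (\<Sum>j = 0..T. complex_of_real (coeff_a Ts j \<theta>) * z ^ (T - j)))"

text \<open>For \<open>T \<le> 1\<close> the parameters are not determined by the transfer function: for \<open>T = 0\<close> it has
  only three coefficients, and for \<open>T = 1\<close> the coefficient \<open>coeff_a Ts 1\<close>, which equals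
  \<open>\<alpha> (1 - \<alpha>) / 2\<close> for the order \<open>\<alpha>\<close>, does not change when \<open>\<alpha>\<close> is replaced by \<open>1 - \<alpha>\<close> (the other
  coefficients are then restored by readjusting the remaining parameters).\<close>

end

theory Submission
  imports Defs
begin

text \<open>Clearing denominators turns equality almost everywhere into a polynomial identity. The direct
  terms agree because the remainders are strictly proper; since the denominators are monic and the
  numerators are monomials of the same degree, all coefficients of the transfer function then agree.
  The order \<open>\<alpha>\<close> is recovered from the ratio \<open>(2 - \<alpha>) / 3\<close> of the denominator coefficients with
  indices 2 and 1, and the remaining parameters follow successively.\<close>

lemma AE_poly_neq_0:
  fixes p :: "complex poly"
  assumes "p \<noteq> 0"
  shows "AE z in lborel. poly p z \<noteq> 0"
proof -
  have "AE z in lborel. z \<notin> {z. poly p z = 0}"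
    by (intro AE_not_in finite_imp_null_set_lborel poly_roots_finite assms)
  then show ?thesis
    by simp
qed

text \<open>A nonzero polynomial has finitely many roots, hence is nonzero almost everywhere;
  vanishing almost everywhere as well would make the whole plane a null set.\<close>

lemma AE_poly_eq_0_imp_eq_0:
  fixes p :: "complex poly"
  assumes "AE z in lborel. poly p z = 0"
  shows "p = 0"
proof (rule ccontr)
  assume "p \<noteq> 0"
  from AE_poly_neq_0[OF this] assms have "AE z in (lborel :: complex measure). False"
    by eventually_elim simp
  then show False
    by (simp add: AE_iff_measurable[OF _ refl])
qed

lemma AE_eq_const_plus_strictly_proper:
  fixes d d' :: complex and n n' p p' :: "complex poly"
  assumes deg: "degree n < degree p" "degree n' < degree p'"
    and eq: "AE z in lborel. d + poly n z / poly p z = d' + poly n' z / poly p' z"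
  shows "d = d'" and "n * p' = n' * p"
proof -
  have nz: "p \<noteq> 0" "p' \<noteq> 0"
    using deg by auto
  define r where "r = n' * p - n * p'"
  have "AE z in lborel. poly (smult (d - d') (p * p') - r) z = 0"
    using eq AE_poly_neq_0[OF nz(1)] AE_poly_neq_0[OF nz(2)]
    by eventually_elim (simp add: r_def field_simps)
  from AE_poly_eq_0_imp_eq_0[OF this] have id: "smult (d - d') (p * p') = r"
    by simp
  \<comment> \<open>Strict properness bounds both products in \<open>r\<close>, whereas a nonzero
    multiple of \<open>p * p'\<close> has full degree, so the scalar \<open>d - d'\<close> must
    vanish.\<close>
  have "degree r < degree (p * p')"
    unfolding r_def
  proof (rule degree_diff_less)
    show "degree (n' * p) < degree (p * p')"
      using degree_mult_le[of n' p] deg nz by (simp add: degree_mult_eq)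
    show "degree (n * p') < degree (p * p')"
      using degree_mult_le[of n p'] deg nz by (simp add: degree_mult_eq)
  qed
  with id show d: "d = d'"
    by (metis degree_smult_eq less_irrefl right_minus_eq)
  with id show "n * p' = n' * p"
    by (simp add: r_def)
qed

definition transfer_denom :: "real \<Rightarrow> nat \<Rightarrow> real ^ 4 \<Rightarrow> complex poly" where
  "transfer_denom Ts T \<theta> =
     monom 1 (T + 1) - (\<Sum>j = 0..T. monom (complex_of_real (coeff_a Ts j \<theta>)) (T - j))"

lemma transfer_fun_eq_poly:
  "transfer_fun Ts T z \<theta> = complex_of_real (coeff_d \<theta>) +
     poly (monom (complex_of_real (coeff_b Ts \<theta>)) T) z / poly (transfer_denom Ts T \<theta>) z"
  by (simp add: transfer_fun_def transfer_denom_def poly_monom poly_sum)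

lemma coeff_transfer_denom_top: "coeff (transfer_denom Ts T \<theta>) (T + 1) = 1"
proof -
  have "(\<Sum>j = 0..T. coeff (monom (complex_of_real (coeff_a Ts j \<theta>)) (T - j)) (T + 1)) = 0"
    by (intro sum.neutral) auto
  then show ?thesis
    by (simp add: transfer_denom_def coeff_sum)
qed

lemma coeff_transfer_denom:
  assumes "k \<le> T"
  shows "coeff (transfer_denom Ts T \<theta>) (T - k) = - complex_of_real (coeff_a Ts k \<theta>)"
proof -
  \<comment> \<open>Subtraction is truncated, but for \<open>j\<close> and \<open>k\<close> up to
    \<open>T\<close> the exponents \<open>T - j\<close> and \<open>T - k\<close> agree only if
    \<open>j = k\<close>.\<close>
  have "(\<Sum>j = 0..T. coeff (monom (complex_of_real (coeff_a Ts j \<theta>)) (T - j)) (T - k)) =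
        (\<Sum>j = 0..T. if j = k then complex_of_real (coeff_a Ts k \<theta>) else 0)"
    using assms by (intro sum.cong) auto
  then show ?thesis
    using assms by (simp add: transfer_denom_def coeff_sum)
qed

lemma degree_transfer_denom: "T < degree (transfer_denom Ts T \<theta>)"
  using le_degree[of "transfer_denom Ts T \<theta>" "T + 1"] coeff_transfer_denom_top[of Ts T \<theta>] by simp

lemma transfer_fun_AE_eq_coeffs:
  assumes eq: "AE z in lborel. transfer_fun Ts T z \<theta> = transfer_fun Ts T z \<theta>'"
    and b: "coeff_b Ts \<theta> \<noteq> 0"
  shows "coeff_d \<theta> = coeff_d \<theta>'" and "coeff_b Ts \<theta> = coeff_b Ts \<theta>'"
    and "k \<le> T \<Longrightarrow> coeff_a Ts k \<theta> = coeff_a Ts k \<theta>'"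
proof -
  let ?P = "transfer_denom Ts T"
  let ?N = "\<lambda>\<theta>. monom (complex_of_real (coeff_b Ts \<theta>)) T"
  have deg: "degree (?N \<theta>) < degree (?P \<theta>)" for \<theta>
    using degree_monom_le degree_transfer_denom by (rule le_less_trans)
  note * = AE_eq_const_plus_strictly_proper[OF deg deg eq[unfolded transfer_fun_eq_poly]]
  from *(1) show "coeff_d \<theta> = coeff_d \<theta>'"
    by simp
  \<comment> \<open>Both numerators are multiples of \<open>z ^ T\<close>, so reading the product
    identity at index \<open>i + T\<close> exposes the \<open>i\<close>-th coefficients of the
    denominators.\<close>
  have coeff_eq: "complex_of_real (coeff_b Ts \<theta>) * coeff (?P \<theta>') i =
      complex_of_real (coeff_b Ts \<theta>') * coeff (?P \<theta>) i" for i
    using arg_cong[OF *(2), of "\<lambda>p. coeff p (i + T)"] by (simp add: coeff_monom_mult)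
  \<comment> \<open>At the leading index both denominators have coefficient 1; at the lower indices
    the common factor \<open>coeff_b\<close>, being nonzero, cancels.\<close>
  from coeff_eq[of "T + 1"] show b_eq: "coeff_b Ts \<theta> = coeff_b Ts \<theta>'"
    by (simp only: coeff_transfer_denom_top) simp
  show "coeff_a Ts k \<theta> = coeff_a Ts k \<theta>'" if "k \<le> T"
    using coeff_eq[of "T - k"] b b_eq by (simp add: coeff_transfer_denom[OF that])
qed

lemma coeff_a_1:
  assumes "0 < alpha1 \<theta>" "alpha1 \<theta> < 1"
  shows "coeff_a Ts 1 \<theta> = alpha1 \<theta> * (1 - alpha1 \<theta>) / 2"
  using gen_binom_eq_gchoose[OF assms, of 2]
  by (simp add: coeff_a_def numeral_2_eq_2 gbinomial_Suc algebra_simps)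

text \<open>Consecutive binomial coefficients satisfy \<open>(\<alpha> gchoose 3) = (\<alpha>
  gchoose 2) * (\<alpha> - 2) / 3\<close>, and the alternating sign turns the factor into
  \<open>2 - \<alpha>\<close>. This ratio is injective in the order, unlike
  \<open>coeff_a Ts 1\<close>, which is symmetric under replacing \<alpha> by
  \<open>1 - \<alpha>\<close>.\<close>

lemma coeff_a_2:
  assumes "0 < alpha1 \<theta>" "alpha1 \<theta> < 1"
  shows "coeff_a Ts 2 \<theta> = coeff_a Ts 1 \<theta> * (2 - alpha1 \<theta>) / 3"
proof -
  have "coeff_a Ts 2 \<theta> = alpha1 \<theta> gchoose 3"
    using gen_binom_eq_gchoose[OF assms, of 3] by (simp add: coeff_a_def)
  also have "\<dots> = coeff_a Ts 1 \<theta> * (2 - alpha1 \<theta>) / 3"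
    unfolding coeff_a_1[OF assms] by (simp add: numeral_3_eq_3 gbinomial_Suc field_simps)
  finally show ?thesis .
qed

theorem proposition2:
  fixes Ts :: real and T :: nat and D :: "(real ^ 4) set"
  assumes "0 < Ts" and "2 \<le> T"
    and "open D" and "D \<subseteq> admissible_params"
  shows "globally_identifiable D (transfer_fun Ts T)"
  unfolding globally_identifiable_def
proof (intro ballI ex1I)
  fix \<theta>' assume \<theta>': "\<theta>' \<in> D"
  then show "\<theta>' \<in> D \<and> (AE z in lborel. transfer_fun Ts T z \<theta>' = transfer_fun Ts T z \<theta>')"
    by simp
  fix \<theta> assume \<theta>: "\<theta> \<in> D \<and> (AE z in lborel. transfer_fun Ts T z \<theta> = transfer_fun Ts T z \<theta>')"
  have adm: "R1 \<theta> \<noteq> 0" "C1 \<theta> \<noteq> 0" "0 < alpha1 \<theta>" "alpha1 \<theta> < 1"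
    and adm': "R1 \<theta>' \<noteq> 0" "C1 \<theta>' \<noteq> 0" "0 < alpha1 \<theta>'" "alpha1 \<theta>' < 1"
    using \<theta> \<theta>' assms(4) by (auto simp: admissible_params_def)
  have "coeff_b Ts \<theta> \<noteq> 0"
    using assms(1) adm by (simp add: coeff_b_def)
  note eqs = transfer_fun_AE_eq_coeffs[OF conjunct2[OF \<theta>] this]
  have a: "coeff_a Ts 0 \<theta> = coeff_a Ts 0 \<theta>'" "coeff_a Ts 1 \<theta> = coeff_a Ts 1 \<theta>'"
      "coeff_a Ts 2 \<theta> = coeff_a Ts 2 \<theta>'"
    using assms(2) by (auto intro: eqs(3))
  \<comment> \<open>The order lies strictly between 0 and 1, so the ratio of the coefficients with
    indices 2 and 1 is defined.\<close>
  have "coeff_a Ts 1 \<theta>' \<noteq> 0"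
    unfolding coeff_a_1[OF adm'(3,4)] using adm' by simp
  then have \<alpha>: "alpha1 \<theta> = alpha1 \<theta>'"
    using a(2,3) coeff_a_2[OF adm(3,4), of Ts] coeff_a_2[OF adm'(3,4), of Ts] by simp
  \<comment> \<open>With equal orders, \<open>Ts powr \<alpha>\<close> is a common positive factor:
    \<open>coeff_b\<close> yields \<open>C1\<close>, and then \<open>coeff_a Ts 0\<close> yields
    \<open>R1\<close>.\<close>
  have C: "C1 \<theta> = C1 \<theta>'"
    using eqs(2) \<alpha> assms(1) adm adm' by (simp add: coeff_b_def field_simps)
  have R: "R1 \<theta> = R1 \<theta>'"
    using a(1) \<alpha> C assms(1) adm adm' by (simp add: coeff_a_def field_simps)
  have "R_inf \<theta> = R_inf \<theta>'"
    using eqs(1) by (simp add: coeff_d_def)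
  then show "\<theta> = \<theta>'"
    using \<alpha> C R by (simp add: vec_eq_iff forall_4)
qed

end
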